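(* Let $G(\mathcal B,\mathcal K)$ be a connected digraph with susceptances $B_k$ and thermal limits $\overline F_k$, $k\in\mathcal K$. Let $\mathcal B = V^1\cup V^2\cup\cdots\cup V^m$ with $V^i\cap V^j=\emptyset$ for all $i\neq j$, such that when, for each $i$, the nodes in $V^i$ are contracted into one node, the resulting graph is a tree. Let $r(G):=\max_{1\le i\le m}|V^i|$, and let $B_{\max}$ and $B_{\min}$ be the maximum and minimum susceptance, respectively. If $d\in\mathbb R^{|\mathcal B|}$ is flow-polytope feasible and $$\overline F_k\;\ge\;\sqrt{\frac{B_{\max}}{B_{\min}}}\,\frac{\sqrt{r(G)-1}}{2}\,\|d\|_1\qquad\text{for all } k\in\bigcup_{i=1}^m E(V^i),$$ then $d$ is also a DCOPF feasible injection.
   Context: The power network is represented as a digraph $G(\mathcal B,\mathcal K)$ whose nodes are buses and whose arcs are transmission lines; arc $k$ goes from its origin $o(k)$ to its destination $d(k)$. Each line $k$ has a susceptance $B_k>0$ and a thermal limit $\overline F_k\ge 0$. $N\in\{0,1,-1\}^{|\mathcal B|\times|\mathcal K|}$ is the node-arc incidence matrix (the column of arc $k$ has $+1$ in row $o(k)$, $-1$ in row $d(k)$, and $0$ elsewhere). For a node set $V^i$, $E(V^i)$ is the set of arcs with both end points in $V^i$. "Connected" and "tree" refer to the underlying undirected graph; contracting each $V^i$ removes the arcs in $E(V^i)$ and keeps all other arcs (parallel arcs are not merged). An injection vector is a vector $d=(d_b)_{b\in\mathcal B}$ of real numbers with $\sum_{b\in\mathcal B} d_b=0$. - $d$ is flow-polytope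 feasible if there exists $f\in\mathbb R^{|\mathcal K|}$ such that $Nf=d$ and $|f_k|\le\overline F_k$ for all $k\in\mathcal K$. - $d$ is DCOPF feasible if there exist $f\in\mathbb R^{|\mathcal K|}$ and $\theta\in\mathbb R^{|\mathcal B|}$ such that $Nf=d$, $|f_k|\le\overline F_k$ for all $k\in\mathcal K$, and $f_k=B_k(\theta_{o(k)}-\theta_{d(k)})$ for all $k\in\mathcal K$ (no bounds are imposed on $\theta$). *)

theory Defs
  imports Complex_Main "Graph_Theory.Digraph_Component"
begin

text \<open>
  \<^const>\<open>forest\<close> and \<^const>\<open>tree\<close> only exclude directed cycles, so an acyclically oriented
  triangle is a \<^const>\<open>tree\<close>. Undirected cycles are therefore expressed as cycles of the digraph
  in which every arc may be traversed in both directions; an arc \<open>e\<close> becomes the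
  two arcs \<open>(e, True)\<close> (forwards) and \<open>(e, False)\<close> (backwards).
\<close>

definition bidirect :: "('a, 'b) pre_digraph \<Rightarrow> ('a, 'b \<times> bool) pre_digraph" where
  "bidirect G = \<lparr> verts = verts G, arcs = arcs G \<times> UNIV,
     tail = (\<lambda>(e, fwd). if fwd then tail G e else head G e),
     head = (\<lambda>(e, fwd). if fwd then head G e else tail G e) \<rparr>"

text \<open>
  The condition \<^prop>\<open>distinct (map fst p)\<close> rules out going back and forth along one arc, while
  two parallel or antiparallel arcs do form a cycle.
\<close>

definition undirected_cycle :: "('a, 'b) pre_digraph \<Rightarrow> ('b \<times> bool) list \<Rightarrow> bool" where
  "undirected_cycle G p \<longleftrightarrow> pre_digraph.cycle (bidirect G) p \<and> distinct (map fst p)"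

definition undirected_tree :: "('a, 'b) pre_digraph \<Rightarrow> bool" where
  "undirected_tree G \<longleftrightarrow> Digraph_Component.connected G \<and> (\<nexists>p. undirected_cycle G p)"

definition arcs_within :: "('a, 'b) pre_digraph \<Rightarrow> 'a set \<Rightarrow> 'b set" where
  "arcs_within G S = {e \<in> arcs G. tail G e \<in> S \<and> head G e \<in> S}"

text \<open>
  The node \<open>i\<close> of the contracted graph stands for the part \<open>V i\<close>. The description is
  well defined on the vertices when \<open>V 1, \<dots>, V m\<close> are disjoint and cover them.
\<close>

definition part_index :: "nat \<Rightarrow> (nat \<Rightarrow> 'a set) \<Rightarrow> 'a \<Rightarrow> nat" where
  "part_index m V v = (THE i. i \<in> {1..m} \<and> v \<in> V i)"

definition contract_parts ::
    "('a, 'b) pre_digraph \<Rightarrow> nat \<Rightarrow> (nat \<Rightarrow> 'a set) \<Rightarrow> (nat, 'b) pre_digraph" where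
  "contract_parts G m V = \<lparr> verts = {1..m},
     arcs = arcs G - (\<Union>i\<in>{1..m}. arcs_within G (V i)),
     tail = (\<lambda>e. part_index m V (tail G e)),
     head = (\<lambda>e. part_index m V (head G e)) \<rparr>"

text \<open>The column of a loop is zero.\<close>

definition incidence :: "('a, 'b) pre_digraph \<Rightarrow> 'a \<Rightarrow> 'b \<Rightarrow> real" where
  "incidence G b k = (if b = tail G k then 1 else 0) - (if b = head G k then 1 else 0)"

text \<open>Vectors indexed by vertices or arcs are functions; values elsewhere are irrelevant.\<close>

definition injection :: "('a, 'b) pre_digraph \<Rightarrow> ('a \<Rightarrow> real) \<Rightarrow> bool" where
  "injection G d \<longleftrightarrow> (\<Sum>b\<in>verts G. d b) = 0"

definition balanced_flow ::
    "('a, 'b) pre_digraph \<Rightarrow> ('b \<Rightarrow> real) \<Rightarrow> ('a \<Rightarrow> real) \<Rightarrow> bool" where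
  "balanced_flow G f d \<longleftrightarrow> (\<forall>b\<in>verts G. (\<Sum>k\<in>arcs G. incidence G b k * f k) = d b)"

definition flow_polytope_feasible ::
    "('a, 'b) pre_digraph \<Rightarrow> ('b \<Rightarrow> real) \<Rightarrow> ('a \<Rightarrow> real) \<Rightarrow> bool" where
  "flow_polytope_feasible G F d \<longleftrightarrow> injection G d \<and>
     (\<exists>f. balanced_flow G f d \<and> (\<forall>k\<in>arcs G. \<bar>f k\<bar> \<le> F k))"

definition dcopf_feasible ::
    "('a, 'b) pre_digraph \<Rightarrow> ('b \<Rightarrow> real) \<Rightarrow> ('b \<Rightarrow> real) \<Rightarrow> ('a \<Rightarrow> real) \<Rightarrow> bool" where
  "dcopf_feasible G B F d \<longleftrightarrow> injection G d \<and>
     (\<exists>f \<theta>. balanced_flow G f d \<and> (\<forall>k\<in>arcs G. \<bar>f k\<bar> \<le> F k) \<and>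
        (\<forall>k\<in>arcs G. f k = B k * (\<theta> (tail G k) - \<theta> (head G k))))"

definition norm1 :: "('a, 'b) pre_digraph \<Rightarrow> ('a \<Rightarrow> real) \<Rightarrow> real" where
  "norm1 G d = (\<Sum>b\<in>verts G. \<bar>d b\<bar>)"

end

theory Submission
  imports Defs
begin

text \<open>
  The flow of a potential minimises the energy \<open>\<Sum>\<^sub>k f\<^sub>k\<^sup>2 / B\<^sub>k\<close> among all flows with the same injection,
  so any other flow whose entries are under control gives a bound for it. This is applied part by
  part, with a flow \<open>g\<close> that lives on a forest.

  An injection that some flow realises is also realised by a flow \<open>f\<close> that comes from a potential
  (\<open>potential_flow_exists\<close>): the weighted Laplacian is symmetric, and a vector in its kernel is
  constant along every arc, hence orthogonal to the injection.

  An arc between two parts is an arc of the contracted graph, which has no cycle. It is therefore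
  the only arc across some cut, not only of the contraction but of \<open>G\<close>
  (\<open>contraction_arc_bridge\<close>). All flows with injection \<open>d\<close> agree on such an arc
  (\<open>flows_agree_on_bridge\<close>), so \<open>f\<close> inherits the thermal limit there from the feasible flow.

  For the arcs inside a part, take a flow \<open>g\<close> with injection \<open>d\<close> and minimal support
  (\<open>forest_flow_exists\<close>). Its support is a forest, because a cycle in it could be cancelled. Each
  \<open>g\<^sub>k\<close> is thus, up to sign, the total injection on one side of a cut, which is at most
  \<open>\<parallel>d\<parallel>\<^sub>1 / 2\<close> in absolute value since \<open>d\<close> sums to zero (\<open>flow_on_bridge_le\<close>), and at most \<open>r - 1\<close> of
  its arcs lie inside a part with \<open>r\<close> nodes (\<open>card_bridges_within\<close>). As \<open>f\<close> and \<open>g\<close> agree on the arcs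
  between parts, \<open>g - f\<close> restricted to one part is a circulation, so the energy comparison already
  holds inside that part (\<open>potential_flow_energy_le\<close>):
  \<open>f\<^sub>k\<^sup>2 / B\<^sub>m\<^sub>a\<^sub>x \<le> \<Sum>\<^sub>j f\<^sub>j\<^sup>2 / B\<^sub>j \<le> \<Sum>\<^sub>j g\<^sub>j\<^sup>2 / B\<^sub>j \<le> (r - 1) (\<parallel>d\<parallel>\<^sub>1 / 2)\<^sup>2 / B\<^sub>m\<^sub>i\<^sub>n\<close>.
  Solving for \<open>f\<^sub>k\<close> gives the stated constant.
\<close>

section \<open>Potentials, flows and cuts\<close>

lemma (in fin_digraph) potential_difference:
  fixes y :: "'a \<Rightarrow> real"
  assumes "k \<in> arcs G"
  shows "(\<Sum>b\<in>verts G. y b * incidence G b k) = y (tail G k) - y (head G k)"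
proof -
  have "(\<Sum>b\<in>verts G. y b * incidence G b k)
      = (\<Sum>b\<in>verts G. (if b = tail G k then y b else 0) - (if b = head G k then y b else 0))"
    by (rule sum.cong) (auto simp: incidence_def)
  also have "\<dots> = y (tail G k) - y (head G k)"
    using assms by (simp add: sum_subtractf)
  finally show ?thesis .
qed

text \<open>
  Summation by parts. With an indicator as potential it computes the flow across a cut, with a
  circulation it says that potential differences are orthogonal to it.
\<close>

lemma (in fin_digraph) sum_potential_injection:
  fixes y :: "'a \<Rightarrow> real"
  assumes "balanced_flow G f d"
  shows "(\<Sum>b\<in>verts G. y b * d b) = (\<Sum>k\<in>arcs G. (y (tail G k) - y (head G k)) * f k)"
proof -
  have "(\<Sum>b\<in>verts G. y b * d b)
      = (\<Sum>b\<in>verts G. \<Sum>k\<in>arcs G. y b * incidence G b k * f k)"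
    using assms by (intro sum.cong) (auto simp: balanced_flow_def sum_distrib_left[symmetric] mult.assoc)
  also have "\<dots> = (\<Sum>k\<in>arcs G. (\<Sum>b\<in>verts G. y b * incidence G b k) * f k)"
    by (subst sum.swap) (simp add: sum_distrib_right)
  finally show ?thesis by (simp add: potential_difference)
qed

lemma balanced_flow_diff:
  assumes "balanced_flow G f d" "balanced_flow G g e"
  shows "balanced_flow G (\<lambda>k. f k - g k) (\<lambda>b. d b - e b)"
  using assms by (simp add: balanced_flow_def right_diff_distrib sum_subtractf)

lemma balanced_flow_add:
  assumes "balanced_flow G f d" "balanced_flow G g e"
  shows "balanced_flow G (\<lambda>k. f k + g k) (\<lambda>b. d b + e b)"
  using assms by (simp add: balanced_flow_def distrib_left sum.distrib)

lemma balanced_flow_scale: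
  assumes "balanced_flow G f d"
  shows "balanced_flow G (\<lambda>k. c * f k) (\<lambda>b. c * d b)"
  unfolding balanced_flow_def
proof
  fix b assume "b \<in> verts G"
  then have "c * (\<Sum>k\<in>arcs G. incidence G b k * f k) = c * d b"
    using assms by (simp add: balanced_flow_def)
  then show "(\<Sum>k\<in>arcs G. incidence G b k * (c * f k)) = c * d b"
    by (simp add: sum_distrib_left mult.left_commute)
qed

text \<open>
  For \<open>k \<in> T\<close> this says that \<open>k\<close> is the only arc of \<open>T\<close> across the cut given by \<open>A\<close>. Bridges are
  described by such cuts rather than by the absence of cycles, because both the value of a flow on
  a bridge and the counting of bridges use the cut. A set all of whose arcs are bridges in it is a forest.
\<close>

definition bridge_in :: "('a, 'b) pre_digraph \<Rightarrow> 'b set \<Rightarrow> 'b \<Rightarrow> bool" where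
  "bridge_in G T k \<longleftrightarrow> (\<exists>A. \<forall>j\<in>T. (tail G j \<in> A) \<noteq> (head G j \<in> A) \<longleftrightarrow> j = k)"

text \<open>
  The sums of \<open>d\<close> over \<open>A\<close> and over its complement are opposite, so the norm counts their common
  absolute value twice.
\<close>

lemma abs_sum_subset_le_half_norm1:
  assumes "finite (verts G)" and "injection G d"
  shows "\<bar>\<Sum>b\<in>verts G \<inter> A. d b\<bar> \<le> norm1 G d / 2"
proof -
  have split: "(\<Sum>b\<in>verts G. h b) = (\<Sum>b\<in>verts G \<inter> A. h b) + (\<Sum>b\<in>verts G - A. h b)"
    for h :: "'a \<Rightarrow> real"
    using assms(1) by (metis sum.Int_Diff)
  have "\<bar>\<Sum>b\<in>verts G \<inter> A. d b\<bar> = \<bar>\<Sum>b\<in>verts G - A. d b\<bar>"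
    using assms(2) split[of d] by (simp add: injection_def)
  moreover have "\<bar>\<Sum>b\<in>verts G \<inter> A. d b\<bar> \<le> (\<Sum>b\<in>verts G \<inter> A. \<bar>d b\<bar>)" by (rule sum_abs)
  moreover have "\<bar>\<Sum>b\<in>verts G - A. d b\<bar> \<le> (\<Sum>b\<in>verts G - A. \<bar>d b\<bar>)" by (rule sum_abs)
  ultimately show ?thesis
    unfolding norm1_def using split[of "\<lambda>b. \<bar>d b\<bar>"] by linarith
qed

text \<open>
  No arc other than \<open>k\<close> carries flow across the cut of \<open>k\<close>, so \<open>k\<close> carries the total injection on
  one side.
\<close>

lemma (in fin_digraph) flow_on_bridge_le:
  assumes f: "balanced_flow G f d" and d: "injection G d"
    and T: "T \<subseteq> arcs G" "\<And>j. j \<in> arcs G - T \<Longrightarrow> f j = 0"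
    and k: "k \<in> T" "bridge_in G T k"
  shows "\<bar>f k\<bar> \<le> norm1 G d / 2"
proof -
  obtain A where A: "\<And>j. j \<in> T \<Longrightarrow> (tail G j \<in> A) \<noteq> (head G j \<in> A) \<longleftrightarrow> j = k"
    using k(2) unfolding bridge_in_def by blast
  define y :: "'a \<Rightarrow> real" where "y = (\<lambda>b. if b \<in> A then 1 else 0)"
  have "(\<Sum>b\<in>verts G \<inter> A. d b) = (\<Sum>b\<in>verts G. y b * d b)"
    unfolding y_def by (simp add: sum.inter_restrict if_distrib[of "\<lambda>x. x * _"] cong: if_cong)
  also have "\<dots> = (\<Sum>j\<in>arcs G. (y (tail G j) - y (head G j)) * f j)"
    using f by (rule sum_potential_injection)
  also have "\<dots> = (\<Sum>j\<in>{k}. (y (tail G j) - y (head G j)) * f j)"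
  proof (rule sum.mono_neutral_right)
    show "\<forall>j\<in>arcs G - {k}. (y (tail G j) - y (head G j)) * f j = 0"
    proof
      fix j assume "j \<in> arcs G - {k}"
      then show "(y (tail G j) - y (head G j)) * f j = 0"
        using A[of j] T(2)[of j] by (cases "j \<in> T") (auto simp: y_def)
    qed
  qed (use k T in auto)
  finally have "\<bar>f k\<bar> = \<bar>\<Sum>b\<in>verts G \<inter> A. d b\<bar>"
    using A[OF k(1)] by (auto simp: y_def)
  then show ?thesis using abs_sum_subset_le_half_norm1[OF finite_verts d] by simp
qed

text \<open>
  The difference of the flows has injection zero, and hence vanishes on bridges.
\<close>

lemma (in fin_digraph) flows_agree_on_bridge:
  assumes "balanced_flow G f d" "balanced_flow G g d" and "k \<in> arcs G" "bridge_in G (arcs G) k"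
  shows "f k = g k"
proof -
  have "balanced_flow G (\<lambda>k. f k - g k) (\<lambda>b. 0)"
    using balanced_flow_diff[OF assms(1,2)] by simp
  from flow_on_bridge_le[OF this _ _ _ assms(3,4)] show ?thesis
    by (simp add: injection_def norm1_def)
qed

text \<open>
  A forest on a finite nonempty set of nodes has fewer arcs than nodes: the cut of any arc inside
  \<open>S\<close> splits \<open>S\<close> into two smaller nonempty sets, and every other arc inside \<open>S\<close> lies inside one of them.
\<close>

lemma (in fin_digraph) card_bridges_within:
  assumes "T \<subseteq> arcs G" "\<And>k. k \<in> T \<Longrightarrow> bridge_in G T k" "finite S" "S \<noteq> {}"
  shows "card (T \<inter> arcs_within G S) + 1 \<le> card S"
  using assms(3,4)
proof (induction S rule: finite_psubset_induct)
  case (psubset S)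
  show ?case
  proof (cases "T \<inter> arcs_within G S = {}")
    case True
    then show ?thesis using psubset by (simp add: Suc_le_eq card_gt_0_iff)
  next
    case False
    then obtain k where k: "k \<in> T" "k \<in> arcs_within G S" by blast
    obtain A where A: "\<And>j. j \<in> T \<Longrightarrow> (tail G j \<in> A) \<noteq> (head G j \<in> A) \<longleftrightarrow> j = k"
      using assms(2)[OF k(1)] unfolding bridge_in_def by blast
    have fin: "finite T" using assms(1) finite_arcs finite_subset by blast
    have ends: "tail G k \<in> S" "head G k \<in> S" "(tail G k \<in> A) \<noteq> (head G k \<in> A)"
      using k A[of k] by (auto simp: arcs_within_def)
    have "card (T \<inter> arcs_within G (S \<inter> A)) + 1 \<le> card (S \<inter> A)"
      by (rule psubset.IH) (use ends in auto)
    moreover have "card (T \<inter> arcs_within G (S - A)) + 1 \<le> card (S - A)"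
      by (rule psubset.IH) (use ends in auto)
    moreover have "T \<inter> arcs_within G S
        \<subseteq> {k} \<union> (T \<inter> arcs_within G (S \<inter> A) \<union> T \<inter> arcs_within G (S - A))"
      using A by (auto simp: arcs_within_def)
    then have "card (T \<inter> arcs_within G S)
        \<le> card ({k} \<union> (T \<inter> arcs_within G (S \<inter> A) \<union> T \<inter> arcs_within G (S - A)))"
      using fin by (intro card_mono) auto
    moreover have "card ({k} \<union> (T \<inter> arcs_within G (S \<inter> A) \<union> T \<inter> arcs_within G (S - A)))
        \<le> 1 + (card (T \<inter> arcs_within G (S \<inter> A)) + card (T \<inter> arcs_within G (S - A)))"
      using card_Un_le[of "{k}" "T \<inter> arcs_within G (S \<inter> A) \<union> T \<inter> arcs_within G (S - A)"]
        card_Un_le[of "T \<inter> arcs_within G (S \<inter> A)" "T \<inter> arcs_within G (S - A)"]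
      by simp
    moreover have "card S = card (S \<inter> A) + card (S - A)"
      using psubset.hyps by (metis card_Diff_subset_Int card_mono finite_Int inf_le1 le_add_diff_inverse)
    ultimately show ?thesis by linarith
  qed
qed

section \<open>Flows supported on a forest\<close>

definition link :: "('a, 'b) pre_digraph \<Rightarrow> 'b set \<Rightarrow> ('a \<times> 'a) set" where
  "link G X = (\<Union>e\<in>X. {(tail G e, head G e), (head G e, tail G e)})"

text \<open>
  The cut is formed by the nodes that can still be reached from one end of \<open>k\<close> without using \<open>k\<close>.
\<close>

lemma bridge_in_or_linked:
  assumes "k \<in> T"
  shows "bridge_in G T k \<or> (head G k, tail G k) \<in> (link G (T - {k}))\<^sup>*"
proof (rule disjCI)
  assume *: "(head G k, tail G k) \<notin> (link G (T - {k}))\<^sup>*"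
  define A where "A = (link G (T - {k}))\<^sup>* `` {head G k}"
  have "tail G j \<in> A \<longleftrightarrow> head G j \<in> A" if "j \<in> T - {k}" for j
  proof -
    have "(tail G j, head G j) \<in> link G (T - {k})" "(head G j, tail G j) \<in> link G (T - {k})"
      using that unfolding link_def by blast+
    then show ?thesis unfolding A_def by (auto intro: rtrancl_into_rtrancl)
  qed
  moreover have "head G k \<in> A" "tail G k \<notin> A" using * by (auto simp: A_def)
  ultimately show "bridge_in G T k" unfolding bridge_in_def by blast
qed

text \<open>
  A flow of one unit along an undirected path. Together with one arc that closes the path it is the
  circulation around a cycle.
\<close>

lemma (in fin_digraph) linked_unit_flow:
  assumes "(u, v) \<in> (link G X)\<^sup>*" "X \<subseteq> arcs G"
  shows "\<exists>c. (\<forall>k. k \<notin> X \<longrightarrow> c k = 0)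
    \<and> balanced_flow G c (\<lambda>b. (if b = u then 1 else 0) - (if b = v then 1 else 0))"
  using assms(1)
proof (induction rule: rtrancl_induct)
  case base
  show ?case by (rule exI[of _ "\<lambda>_. 0"]) (simp add: balanced_flow_def)
next
  case (step v w)
  then obtain c where c: "\<forall>k. k \<notin> X \<longrightarrow> c k = 0"
    "balanced_flow G c (\<lambda>b. (if b = u then 1 else 0) - (if b = v then 1 else 0))" by blast
  obtain e where e: "e \<in> X" "(v, w) = (tail G e, head G e) \<or> (v, w) = (head G e, tail G e)"
    using step.hyps unfolding link_def by blast
  define s :: real where "s = (if (v, w) = (tail G e, head G e) then 1 else -1)"
  have "(\<Sum>k\<in>arcs G. incidence G b k * (if k = e then s else 0)) = incidence G b e * s" for b
    using e(1) assms(2) by (auto simp: if_distrib[of "\<lambda>x. _ * x"] cong: if_cong)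
  then have "balanced_flow G (\<lambda>k. if k = e then s else 0)
      (\<lambda>b. (if b = v then 1 else 0) - (if b = w then 1 else 0))"
    using e(2) by (auto simp: balanced_flow_def incidence_def s_def)
  from balanced_flow_add[OF c(2) this] c(1) e(1) show ?case
    by (intro exI[of _ "\<lambda>k. c k + (if k = e then s else 0)"]) auto
qed

text \<open>
  A flow of minimal support will do: an arc of the support that is not a bridge lies on a cycle of
  the support, and subtracting the right multiple of the circulation around it removes the arc
  from the support without adding any other.
\<close>

lemma (in fin_digraph) forest_flow_exists:
  assumes "balanced_flow G f d"
  obtains g T where "balanced_flow G g d" "T \<subseteq> arcs G" "\<And>k. k \<in> arcs G - T \<Longrightarrow> g k = 0"
    "\<And>k. k \<in> T \<Longrightarrow> bridge_in G T k"
proof -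
  define supp where "supp = (\<lambda>g :: 'b \<Rightarrow> real. {k \<in> arcs G. g k \<noteq> 0})"
  obtain g where g: "balanced_flow G g d"
    and min: "\<And>g'. balanced_flow G g' d \<Longrightarrow> card (supp g) \<le> card (supp g')"
    using ex_has_least_nat[of "\<lambda>g. balanced_flow G g d" f "\<lambda>g. card (supp g)"]
      assms by blast
  have "bridge_in G (supp g) k" if k: "k \<in> supp g" for k
  proof (rule ccontr)
    assume "\<not> bridge_in G (supp g) k"
    then have "(head G k, tail G k) \<in> (link G (supp g - {k}))\<^sup>*"
      using bridge_in_or_linked[OF k, of G] by blast
    then obtain c where c: "\<And>j. j \<notin> supp g - {k} \<Longrightarrow> c j = 0" "balanced_flow G c
        (\<lambda>b. (if b = head G k then 1 else 0) - (if b = tail G k then 1 else 0))"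
      using linked_unit_flow[of "head G k" "tail G k" "supp g - {k}"] by (auto simp: supp_def)
    \<comment> \<open>One unit along \<open>k\<close> closes the path flow \<open>c\<close> to a circulation.\<close>
    have "balanced_flow G (\<lambda>j. if j = k then 1 else 0) (\<lambda>b. incidence G b k)"
      using k by (auto simp: balanced_flow_def supp_def if_distrib[of "\<lambda>x. _ * x"] cong: if_cong)
    from balanced_flow_add[OF c(2) this]
    have "balanced_flow G (\<lambda>j. c j + (if j = k then 1 else 0)) (\<lambda>b. 0)"
      by (simp add: incidence_def)
    from balanced_flow_diff[OF g balanced_flow_scale[OF this, of "g k"]]
    have "balanced_flow G (\<lambda>j. g j - g k * (c j + (if j = k then 1 else 0))) d" by simp
    from min[OF this]
    have "card (supp g) \<le> card (supp (\<lambda>j. g j - g k * (c j + (if j = k then 1 else 0))))" .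
    moreover have "supp (\<lambda>j. g j - g k * (c j + (if j = k then 1 else 0))) \<subset> supp g"
      using k c(1) by (auto simp: supp_def)
    then have "card (supp (\<lambda>j. g j - g k * (c j + (if j = k then 1 else 0)))) < card (supp g)"
      by (rule psubset_card_mono[rotated]) (simp add: supp_def)
    ultimately show False by simp
  qed
  with g show thesis by (intro that[of g "supp g"]) (auto simp: supp_def)
qed

section \<open>Acyclicity and contraction\<close>

lemma wf_digraph_bidirect:
  assumes "wf_digraph G"
  shows "wf_digraph (bidirect G)"
proof -
  interpret wf_digraph G by fact
  show ?thesis by unfold_locales (auto simp: bidirect_def split: if_splits)
qed

lemma (in wf_digraph) apath_suffix:
  assumes "apath u p v" "x \<in> set (awalk_verts u p)"
  shows "\<exists>r. set r \<subseteq> set p \<and> apath x r v"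
  using assms
proof (induction p arbitrary: u)
  case Nil
  then show ?case by (auto simp: apath_simps)
next
  case (Cons e p)
  show ?case
  proof (cases "x = u")
    case True
    then show ?thesis using Cons.prems by (intro exI[of _ "e # p"]) auto
  next
    case False
    then show ?thesis using Cons.IH[of "head G e"] Cons.prems by (auto simp: apath_simps)
  qed
qed

text \<open>
  The path is built backwards from \<open>v\<close>; when the next node already occurs on it, the piece before
  that node is dropped, which keeps the path simple.
\<close>

lemma linked_imp_apath_bidirect:
  assumes "wf_digraph G" "X \<subseteq> arcs G" "(u, v) \<in> (link G X)\<^sup>*" "v \<in> verts G"
  shows "\<exists>p. fst ` set p \<subseteq> X \<and> pre_digraph.apath (bidirect G) u p v"
proof -
  interpret D: wf_digraph "bidirect G" using assms(1) by (rule wf_digraph_bidirect)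
  show ?thesis using assms(3)
  proof (induction rule: converse_rtrancl_induct)
    case base
    have "v \<in> verts (bidirect G)" using assms(4) by (simp add: bidirect_def)
    then show ?case by (intro exI[of _ "[]"]) (simp add: D.apath_simps)
  next
    case (step u w)
    then obtain p where p: "fst ` set p \<subseteq> X" "D.apath w p v" by blast
    obtain e where e: "e \<in> X" "(u, w) = (tail G e, head G e) \<or> (u, w) = (head G e, tail G e)"
      using step.hyps unfolding link_def by blast
    define a where "a = (e, (u, w) = (tail G e, head G e))"
    have a: "a \<in> arcs (bidirect G)" "tail (bidirect G) a = u" "head (bidirect G) a = w"
      using e assms(2) by (auto simp: a_def bidirect_def)
    show ?case
    proof (cases "u \<in> set (D.awalk_verts w p)")
      case True
      from D.apath_suffix[OF p(2) this] p(1) show ?thesis by blast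
    next
      case False
      then show ?thesis using a p e(1)
        by (intro exI[of _ "a # p"]) (auto simp: D.apath_simps a_def)
    qed
  qed
qed

text \<open>
  A simple path uses no arc twice, not even in opposite directions, since it would come back to an
  end point that it has left.
\<close>

lemma apath_bidirect_distinct_arcs:
  assumes "wf_digraph G" "pre_digraph.apath (bidirect G) u p v"
  shows "distinct (map fst p)"
proof -
  interpret D: wf_digraph "bidirect G" using assms(1) by (rule wf_digraph_bidirect)
  show ?thesis using assms(2)
  proof (induction p arbitrary: u)
    case (Cons a p)
    then have a: "tail (bidirect G) a = u" "D.apath (head (bidirect G) a) p v"
      "u \<notin> set (D.awalk_verts (head (bidirect G) a) p)" by (auto simp: D.apath_simps)
    have "fst c \<noteq> fst a" if "c \<in> set p" for c
    proof
      assume "fst c = fst a"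
      then have "u = tail (bidirect G) c \<or> u = head (bidirect G) c"
        using a(1) by (auto simp: bidirect_def split: prod.splits if_splits)
      moreover have "{tail (bidirect G) c, head (bidirect G) c}
          \<subseteq> set (D.awalk_verts (head (bidirect G) a) p)"
        using that D.set_awalk_verts[OF D.awalkI_apath[OF a(2)]] by auto
      ultimately show False using a(3) by auto
    qed
    then show ?case using Cons.IH[OF a(2)] by fastforce
  qed simp
qed

text \<open>
  If the ends of \<open>k\<close> were linked without \<open>k\<close>, a simple path between them followed by \<open>k\<close> would be
  an undirected cycle.
\<close>

lemma bridge_in_acyclic:
  assumes wf: "wf_digraph G" and acyclic: "\<nexists>p. undirected_cycle G p" and k: "k \<in> arcs G"
  shows "bridge_in G (arcs G) k"
proof (rule ccontr)
  interpret wf_digraph G by fact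
  interpret D: wf_digraph "bidirect G" using wf by (rule wf_digraph_bidirect)
  assume "\<not> bridge_in G (arcs G) k"
  then have "(head G k, tail G k) \<in> (link G (arcs G - {k}))\<^sup>*"
    using bridge_in_or_linked[OF k, of G] by blast
  then obtain p where p: "fst ` set p \<subseteq> arcs G - {k}" "D.apath (head G k) p (tail G k)"
    using linked_imp_apath_bidirect[OF wf] k by (meson Diff_subset tail_in_verts)
  have "(k, True) \<in> arcs (bidirect G)" "tail (bidirect G) (k, True) = tail G k"
    "head (bidirect G) (k, True) = head G k" using k by (auto simp: bidirect_def)
  then have "D.cycle ((k, True) # p)"
    using p(2) unfolding D.cycle_def D.apath_def
    by (intro exI[of _ "tail G k"]) (auto simp: D.awalk_simps)
  moreover have "distinct (map fst ((k, True) # p))"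
    using apath_bidirect_distinct_arcs[OF wf p(2)] p(1) by force
  ultimately show False using acyclic unfolding undirected_cycle_def by blast
qed

lemma part_index_eq:
  assumes "\<And>i j. i \<in> {1..m} \<Longrightarrow> j \<in> {1..m} \<Longrightarrow> i \<noteq> j \<Longrightarrow> V i \<inter> V j = {}"
    and "i \<in> {1..m}" "v \<in> V i"
  shows "part_index m V v = i"
  unfolding part_index_def
proof (rule the_equality)
  fix j assume "j \<in> {1..m} \<and> v \<in> V j"
  then show "j = i" using assms(1)[of j i] assms(2,3) by blast
qed (use assms(2,3) in simp)

text \<open>
  A cut of the contracted graph pulls back to a cut of \<open>G\<close>, and no arc inside a part crosses the
  pulled back cut.
\<close>

lemma contraction_arc_bridge:
  assumes G: "wf_digraph G" and V: "verts G = (\<Union>i\<in>{1..m}. V i)"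
    and disj: "\<And>i j. i \<in> {1..m} \<Longrightarrow> j \<in> {1..m} \<Longrightarrow> i \<noteq> j \<Longrightarrow> V i \<inter> V j = {}"
    and acyclic: "\<nexists>p. undirected_cycle (contract_parts G m V) p"
    and k: "k \<in> arcs (contract_parts G m V)"
  shows "bridge_in G (arcs G) k"
proof -
  interpret wf_digraph G by fact
  let ?H = "contract_parts G m V" and ?\<pi> = "part_index m V"
  note \<pi>_eq = part_index_eq[where m = m and V = V, OF disj]
  have index: "?\<pi> v \<in> {1..m}" if "v \<in> verts G" for v
    using that V \<pi>_eq by auto
  have "wf_digraph ?H"
  proof
    fix e assume "e \<in> arcs ?H"
    then have "e \<in> arcs G" by (simp add: contract_parts_def)
    then show "tail ?H e \<in> verts ?H" "head ?H e \<in> verts ?H"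
      using index[OF tail_in_verts] index[OF head_in_verts] by (simp_all add: contract_parts_def)
  qed
  from bridge_in_acyclic[OF this acyclic k] obtain A where
    "\<forall>j\<in>arcs ?H. (tail ?H j \<in> A) \<noteq> (head ?H j \<in> A) \<longleftrightarrow> j = k"
    unfolding bridge_in_def by (elim exE)
  then have A: "(?\<pi> (tail G j) \<in> A) \<noteq> (?\<pi> (head G j) \<in> A) \<longleftrightarrow> j = k" if "j \<in> arcs ?H" for j
    using that by (simp add: contract_parts_def)
  have "(tail G j \<in> ?\<pi> -` A) \<noteq> (head G j \<in> ?\<pi> -` A) \<longleftrightarrow> j = k" if j: "j \<in> arcs G" for j
  proof (cases "j \<in> arcs ?H")
    case True
    then show ?thesis using A by simp
  next
    case False
    then obtain i where "i \<in> {1..m}" "tail G j \<in> V i" "head G j \<in> V i"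
      using j by (auto simp: contract_parts_def arcs_within_def)
    then have "?\<pi> (tail G j) = ?\<pi> (head G j)" using \<pi>_eq by metis
    moreover have "j \<noteq> k" using False k by blast
    ultimately show ?thesis by simp
  qed
  then show ?thesis unfolding bridge_in_def by (intro exI[of _ "?\<pi> -` A"] ballI)
qed

section \<open>Flows induced by potentials\<close>

text \<open>
  The Fredholm alternative: a linear system is solvable unless some vector is orthogonal to
  all columns of the matrix but not to the right-hand side. Columns are added one at a time. If some \<open>z\<close> is
  orthogonal to the earlier columns but not to the new one, then \<open>z\<close> determines the coefficient of
  the new column, and the induction hypothesis is applied to what remains of the right-hand side.
\<close>

lemma fredholm_alternative:
  fixes a :: "'i \<Rightarrow> 'j \<Rightarrow> real" and b :: "'i \<Rightarrow> real"
  assumes "finite I" "finite J"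
  shows "(\<exists>x. \<forall>i\<in>I. (\<Sum>j\<in>J. a i j * x j) = b i)
    \<or> (\<exists>y. (\<forall>j\<in>J. (\<Sum>i\<in>I. y i * a i j) = 0) \<and> (\<Sum>i\<in>I. y i * b i) \<noteq> 0)"
  using assms(2)
proof (induction J arbitrary: b rule: finite_induct)
  case empty
  show ?case unfolding disj_imp
  proof
    assume "\<nexists>x. \<forall>i\<in>I. (\<Sum>j\<in>{}. a i j * x j) = b i"
    then obtain i where "i \<in> I" "b i \<noteq> 0" by auto
    then show "\<exists>y. (\<forall>j\<in>{}. (\<Sum>i\<in>I. y i * a i j) = 0) \<and> (\<Sum>i\<in>I. y i * b i) \<noteq> 0"
      using assms(1) by (intro exI[of _ "\<lambda>x. if x = i then 1 else 0"])
        (simp add: if_distrib[of "\<lambda>x. x * _"] cong: if_cong)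
  qed
next
  case (insert l J)
  show ?case
  proof (cases "\<exists>z. (\<forall>j\<in>J. (\<Sum>i\<in>I. z i * a i j) = 0) \<and> (\<Sum>i\<in>I. z i * a i l) \<noteq> 0")
    case True
    then obtain z where z: "\<And>j. j \<in> J \<Longrightarrow> (\<Sum>i\<in>I. z i * a i j) = 0" "(\<Sum>i\<in>I. z i * a i l) \<noteq> 0"
      by blast
    define q where "q = (\<Sum>i\<in>I. z i * a i l)"
    define t where "t = (\<Sum>i\<in>I. z i * b i) / q"
    from insert.IH[of "\<lambda>i. b i - t * a i l"] show ?thesis
    proof (elim disjE exE conjE)
      fix x assume x: "\<forall>i\<in>I. (\<Sum>j\<in>J. a i j * x j) = b i - t * a i l"
      have "(\<Sum>j\<in>J. a i j * (x(l := t)) j) = (\<Sum>j\<in>J. a i j * x j)" for i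
        using insert.hyps by (intro sum.cong) auto
      then have "\<forall>i\<in>I. (\<Sum>j\<in>insert l J. a i j * (x(l := t)) j) = b i"
        using x insert.hyps by simp
      then show ?thesis by blast
    next
      fix y assume y: "\<forall>j\<in>J. (\<Sum>i\<in>I. y i * a i j) = 0"
        "(\<Sum>i\<in>I. y i * (b i - t * a i l)) \<noteq> 0"
      \<comment> \<open>Subtracting this multiple of \<open>z\<close> makes \<open>y\<close> orthogonal to the new column as well.\<close>
      define s where "s = (\<Sum>i\<in>I. y i * a i l) / q"
      have comb: "(\<Sum>i\<in>I. (y i - s * z i) * h i) = (\<Sum>i\<in>I. y i * h i) - s * (\<Sum>i\<in>I. z i * h i)"
        for h :: "'i \<Rightarrow> real"
        by (simp add: left_diff_distrib sum_subtractf sum_distrib_left mult.assoc)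
      have "(\<Sum>i\<in>I. (y i - s * z i) * a i j) = 0" if "j \<in> insert l J" for j
        using that y(1) z unfolding comb by (auto simp: s_def q_def)
      moreover have "(\<Sum>i\<in>I. y i * (b i - t * a i l))
          = (\<Sum>i\<in>I. y i * b i) - t * (\<Sum>i\<in>I. y i * a i l)"
        by (simp add: right_diff_distrib sum_subtractf sum_distrib_left mult.left_commute)
      then have "(\<Sum>i\<in>I. (y i - s * z i) * b i) = (\<Sum>i\<in>I. y i * (b i - t * a i l))"
        unfolding comb by (simp add: s_def t_def)
      ultimately show ?thesis using y(2) by metis
    qed
  next
    case False
    from insert.IH[of b] show ?thesis
    proof (elim disjE exE conjE)
      fix x assume x: "\<forall>i\<in>I. (\<Sum>j\<in>J. a i j * x j) = b i"
      have "(\<Sum>j\<in>J. a i j * (x(l := 0)) j) = (\<Sum>j\<in>J. a i j * x j)" for i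
        using insert.hyps by (intro sum.cong) auto
      then have "\<forall>i\<in>I. (\<Sum>j\<in>insert l J. a i j * (x(l := 0)) j) = b i"
        using x insert.hyps by simp
      then show ?thesis by blast
    next
      fix y assume "\<forall>j\<in>J. (\<Sum>i\<in>I. y i * a i j) = 0" "(\<Sum>i\<in>I. y i * b i) \<noteq> 0"
      then show ?thesis using False by blast
    qed
  qed
qed

text \<open>
  The matrix is the Laplacian \<open>N diag(B) N\<^sup>T\<close>. If \<open>y\<close> is in its kernel, then the energy
  \<open>y\<^sup>T N diag(B) N\<^sup>T y\<close> vanishes, so that \<open>y\<close> is constant along arcs and hence orthogonal to every
  injection that some flow realises. By the Fredholm alternative the Laplacian system is solvable.
\<close>

lemma (in fin_digraph) potential_flow_exists:
  assumes f: "balanced_flow G f d" and B: "\<And>k. k \<in> arcs G \<Longrightarrow> B k > 0"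
  shows "\<exists>\<theta>. balanced_flow G (\<lambda>k. B k * (\<theta> (tail G k) - \<theta> (head G k))) d"
proof -
  define L where "L = (\<lambda>b c. \<Sum>k\<in>arcs G. incidence G b k * B k * incidence G c k)"
  have L: "(\<Sum>c\<in>verts G. L b c * \<theta> c)
      = (\<Sum>k\<in>arcs G. incidence G b k * (B k * (\<theta> (tail G k) - \<theta> (head G k))))" for b \<theta>
  proof -
    have "(\<Sum>c\<in>verts G. L b c * \<theta> c)
        = (\<Sum>k\<in>arcs G. incidence G b k * (B k * (\<Sum>c\<in>verts G. \<theta> c * incidence G c k)))"
      unfolding L_def sum_distrib_right by (subst sum.swap)
        (simp add: sum_distrib_left mult.assoc mult.commute[of "incidence G _ _" "\<theta> _"])
    then show ?thesis by (simp add: potential_difference)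
  qed
  have sym: "L b c = L c b" for b c
    unfolding L_def by (intro sum.cong) (auto simp: mult_ac)
  consider \<theta> where "\<forall>b\<in>verts G. (\<Sum>c\<in>verts G. L b c * \<theta> c) = d b"
    | y where "\<forall>c\<in>verts G. (\<Sum>b\<in>verts G. y b * L b c) = 0" "(\<Sum>b\<in>verts G. y b * d b) \<noteq> 0"
    using fredholm_alternative[OF finite_verts finite_verts, of L d] by blast
  then show ?thesis
  proof cases
    case 1
    then show ?thesis unfolding L balanced_flow_def by blast
  next
    case 2
    have "\<forall>c\<in>verts G. (\<Sum>b\<in>verts G. L c b * y b) = 0"
      using 2(1) by (simp add: sym[of _ "_"] mult.commute)
    then have "balanced_flow G (\<lambda>k. B k * (y (tail G k) - y (head G k))) (\<lambda>_. 0)"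
      unfolding L balanced_flow_def .
    from sum_potential_injection[OF this, of y]
    have "(\<Sum>k\<in>arcs G. B k * (y (tail G k) - y (head G k))\<^sup>2) = 0"
      by (simp add: power2_eq_square mult_ac)
    then have "\<forall>k\<in>arcs G. B k * (y (tail G k) - y (head G k))\<^sup>2 = 0"
      using B by (subst (asm) sum_nonneg_eq_0_iff) (simp_all add: less_imp_le)
    then have "\<forall>k\<in>arcs G. y (tail G k) - y (head G k) = 0"
      using B by (metis less_irrefl mult_eq_0_iff zero_eq_power2)
    then have "(\<Sum>b\<in>verts G. y b * d b) = 0"
      using sum_potential_injection[OF f, of y] by simp
    with 2(2) show ?thesis by contradiction
  qed
qed

text \<open>
  Thomson's principle, localised to \<open>S\<close>. Cutting \<open>\<theta>\<close> off outside \<open>S\<close> changes its differences only on arcs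
  that are not inside \<open>S\<close>; those across the boundary do not count because \<open>g - f\<close> vanishes there.
  Hence \<open>f / B\<close> on the arcs inside \<open>S\<close> is orthogonal to \<open>g - f\<close>.
\<close>

lemma (in fin_digraph) potential_flow_energy_le:
  assumes f: "balanced_flow G f d" "\<And>k. k \<in> arcs G \<Longrightarrow> f k = B k * (\<theta> (tail G k) - \<theta> (head G k))"
    and B: "\<And>k. k \<in> arcs G \<Longrightarrow> B k > 0"
    and g: "balanced_flow G g d"
    and agree: "\<And>k. k \<in> arcs G \<Longrightarrow> (tail G k \<in> S) \<noteq> (head G k \<in> S) \<Longrightarrow> g k = f k"
  shows "(\<Sum>k\<in>arcs_within G S. (f k)\<^sup>2 / B k) \<le> (\<Sum>k\<in>arcs_within G S. (g k)\<^sup>2 / B k)"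
proof -
  define y where "y = (\<lambda>b. if b \<in> S then \<theta> b else 0)"
  have sub: "arcs_within G S \<subseteq> arcs G" by (auto simp: arcs_within_def)
  have h: "balanced_flow G (\<lambda>k. g k - f k) (\<lambda>b. 0)"
    using balanced_flow_diff[OF g f(1)] by simp
  have "0 = (\<Sum>k\<in>arcs G. (y (tail G k) - y (head G k)) * (g k - f k))"
    using sum_potential_injection[OF h, of y] by simp
  also have "\<dots> = (\<Sum>k\<in>arcs_within G S. (y (tail G k) - y (head G k)) * (g k - f k))"
  proof (rule sum.mono_neutral_right)
    show "\<forall>k\<in>arcs G - arcs_within G S. (y (tail G k) - y (head G k)) * (g k - f k) = 0"
      using agree by (auto simp: arcs_within_def y_def)
  qed (use sub in auto)
  also have "\<dots> = (\<Sum>k\<in>arcs_within G S. f k * (g k - f k) / B k)"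
  proof (rule sum.cong)
    fix k assume k: "k \<in> arcs_within G S"
    with sub B[of k] have "y (tail G k) - y (head G k) = f k / B k"
      using f(2)[of k] by (auto simp: arcs_within_def y_def field_simps)
    then show "(y (tail G k) - y (head G k)) * (g k - f k) = f k * (g k - f k) / B k" by simp
  qed simp
  finally have orth: "(\<Sum>k\<in>arcs_within G S. f k * (g k - f k) / B k) = 0" by simp
  \<comment> \<open>Pythagoras: \<open>g\<^sup>2 = f\<^sup>2 + 2 f (g - f) + (g - f)\<^sup>2\<close>, and the mixed terms sum to zero.\<close>
  have "(\<Sum>k\<in>arcs_within G S. (f k)\<^sup>2 / B k)
      = (\<Sum>k\<in>arcs_within G S. (f k)\<^sup>2 / B k + 2 * (f k * (g k - f k) / B k))"
    unfolding sum.distrib sum_distrib_left[symmetric] orth by simp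
  also have "\<dots> \<le> (\<Sum>k\<in>arcs_within G S. (g k)\<^sup>2 / B k)"
  proof (rule sum_mono)
    fix k assume "k \<in> arcs_within G S"
    with sub B have "B k > 0" by blast
    moreover have "0 \<le> (g k - f k)\<^sup>2" by simp
    then have "(f k)\<^sup>2 + 2 * (f k * (g k - f k)) \<le> (g k)\<^sup>2"
      by (simp add: power2_eq_square algebra_simps)
    ultimately show "(f k)\<^sup>2 / B k + 2 * (f k * (g k - f k) / B k) \<le> (g k)\<^sup>2 / B k"
      by (simp add: divide_simps)
  qed
  finally show ?thesis .
qed

text \<open>
  The energy of the potential flow inside \<open>S\<close> is compared with that of a forest flow, which has at
  most \<open>card S - 1\<close> nonzero entries there, each at most half the norm of the injection.
\<close>

lemma (in fin_digraph) potential_flow_within_part_le: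
  assumes f: "balanced_flow G f d" "\<And>k. k \<in> arcs G \<Longrightarrow> f k = B k * (\<theta> (tail G k) - \<theta> (head G k))"
    and B: "\<And>k. k \<in> arcs G \<Longrightarrow> B k > 0" and d: "injection G d"
    and S: "finite S"
      "\<And>k. k \<in> arcs G \<Longrightarrow> (tail G k \<in> S) \<noteq> (head G k \<in> S) \<Longrightarrow> bridge_in G (arcs G) k"
    and k: "k \<in> arcs_within G S"
  shows "\<bar>f k\<bar> \<le> sqrt (Max (B ` arcs G) / Min (B ` arcs G))
    * (sqrt (real (card S) - 1) / 2) * norm1 G d"
proof -
  define M where "M = Max (B ` arcs G)"
  define \<mu> where "\<mu> = Min (B ` arcs G)"
  define D where "D = norm1 G d"
  have k': "k \<in> arcs G" "S \<noteq> {}" using k by (auto simp: arcs_within_def)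
  have sub: "arcs_within G S \<subseteq> arcs G" by (auto simp: arcs_within_def)
  have fin: "finite (arcs_within G S)" using sub finite_arcs finite_subset by blast
  have M: "B j \<le> M" and \<mu>: "\<mu> \<le> B j" if "j \<in> arcs G" for j
    using that by (auto simp: M_def \<mu>_def)
  have "\<mu> \<in> B ` arcs G" unfolding \<mu>_def using k' by (intro Min_in) auto
  then have \<mu>0: "\<mu> > 0" using B by auto
  have M0: "M > 0" using M[OF k'(1)] B[OF k'(1)] by linarith
  have D0: "D \<ge> 0" by (simp add: D_def norm1_def sum_nonneg)
  have r: "real (card S) - 1 \<ge> 0" using S(1) k'(2) by (simp add: Suc_le_eq card_gt_0_iff)
  obtain g T where g: "balanced_flow G g d" and T: "T \<subseteq> arcs G" "\<And>j. j \<in> arcs G - T \<Longrightarrow> g j = 0"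
    "\<And>j. j \<in> T \<Longrightarrow> bridge_in G T j" using forest_flow_exists[OF f(1)] by metis
  have gT: "\<bar>g j\<bar> \<le> D / 2" if "j \<in> T" for j
    unfolding D_def using flow_on_bridge_le[OF g d T(1,2) that T(3)[OF that]] .
  have "(f k)\<^sup>2 / M \<le> (f k)\<^sup>2 / B k"
    using M[OF k'(1)] B[OF k'(1)] by (simp add: frac_le)
  also have "\<dots> \<le> (\<Sum>j\<in>arcs_within G S. (f j)\<^sup>2 / B j)"
    using k fin sub B by (intro member_le_sum) (auto simp: less_imp_le subset_iff)
  also have "\<dots> \<le> (\<Sum>j\<in>arcs_within G S. (g j)\<^sup>2 / B j)"
    by (rule potential_flow_energy_le[OF f B g])
      (use flows_agree_on_bridge[OF g f(1)] S(2) in auto)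
  also have "\<dots> = (\<Sum>j\<in>T \<inter> arcs_within G S. (g j)\<^sup>2 / B j)"
    using fin sub T(2) by (intro sum.mono_neutral_right) auto
  also have "\<dots> \<le> (\<Sum>j\<in>T \<inter> arcs_within G S. (D / 2)\<^sup>2 / \<mu>)"
  proof (rule sum_mono)
    fix j assume j: "j \<in> T \<inter> arcs_within G S"
    have "(g j)\<^sup>2 \<le> (D / 2)\<^sup>2"
      using gT[of j] j by (metis IntD1 abs_le_square_iff abs_of_nonneg abs_ge_zero order_trans)
    then show "(g j)\<^sup>2 / B j \<le> (D / 2)\<^sup>2 / \<mu>"
      using \<mu>[of j] \<mu>0 j sub by (intro frac_le) auto
  qed
  also have "\<dots> = real (card (T \<inter> arcs_within G S)) * ((D / 2)\<^sup>2 / \<mu>)" by simp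
  also have "\<dots> \<le> (real (card S) - 1) * ((D / 2)\<^sup>2 / \<mu>)"
    using card_bridges_within[OF T(1,3) S(1) k'(2)] \<mu>0 by (intro mult_right_mono) auto
  finally have "(f k)\<^sup>2 \<le> M * ((real (card S) - 1) * ((D / 2)\<^sup>2 / \<mu>))"
    using M0 by (simp add: field_simps)
  also have "\<dots> = (sqrt (M / \<mu>) * (sqrt (real (card S) - 1) / 2) * D)\<^sup>2"
    using M0 \<mu>0 r by (simp add: power_mult_distrib power_divide)
  finally have "\<bar>f k\<bar> \<le> \<bar>sqrt (M / \<mu>) * (sqrt (real (card S) - 1) / 2) * D\<bar>"
    by (simp only: abs_le_square_iff)
  also have "\<dots> = sqrt (M / \<mu>) * (sqrt (real (card S) - 1) / 2) * D"
    using M0 \<mu>0 r D0 by (intro abs_of_nonneg) auto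
  finally show ?thesis unfolding M_def \<mu>_def D_def .
qed

theorem theorem1:
  fixes G :: "('a, 'b) pre_digraph"
    and B F :: "'b \<Rightarrow> real"
    and m :: nat and V :: "nat \<Rightarrow> 'a set"
    and d :: "'a \<Rightarrow> real"
  assumes "fin_digraph G"
    and "Digraph_Component.connected G"
    and "\<And>k. k \<in> arcs G \<Longrightarrow> B k > 0"
    and "\<And>k. k \<in> arcs G \<Longrightarrow> F k \<ge> 0"
    and "verts G = (\<Union>i\<in>{1..m}. V i)"
    and "\<And>i j. i \<in> {1..m} \<Longrightarrow> j \<in> {1..m} \<Longrightarrow> i \<noteq> j \<Longrightarrow> V i \<inter> V j = {}"
    and "undirected_tree (contract_parts G m V)"
    and "flow_polytope_feasible G F d"
    and "\<And>k. k \<in> (\<Union>i\<in>{1..m}. arcs_within G (V i)) \<Longrightarrow>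
           F k \<ge> sqrt (Max (B ` arcs G) / Min (B ` arcs G))
                  * (sqrt (real (Max ((\<lambda>i. card (V i)) ` {1..m})) - 1) / 2) * norm1 G d"
  shows "dcopf_feasible G B F d"
proof -
  interpret fin_digraph G by fact
  obtain f\<^sub>0 where inj: "injection G d" and f\<^sub>0: "balanced_flow G f\<^sub>0 d"
    "\<And>k. k \<in> arcs G \<Longrightarrow> \<bar>f\<^sub>0 k\<bar> \<le> F k"
    using assms(8) unfolding flow_polytope_feasible_def by blast
  obtain \<theta> where \<theta>: "balanced_flow G (\<lambda>k. B k * (\<theta> (tail G k) - \<theta> (head G k))) d"
    using potential_flow_exists[where B = B, OF f\<^sub>0(1) assms(3)] by blast
  define f where "f = (\<lambda>k. B k * (\<theta> (tail G k) - \<theta> (head G k)))"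
  have f: "balanced_flow G f d" using \<theta> by (simp add: f_def)
  have bridge: "bridge_in G (arcs G) k" if "k \<in> arcs (contract_parts G m V)" for k
    using contraction_arc_bridge[OF wf_digraph assms(5,6) _ that] assms(7)
    unfolding undirected_tree_def by blast
  have "\<bar>f k\<bar> \<le> F k" if k: "k \<in> arcs G" for k
  proof (cases "k \<in> arcs (contract_parts G m V)")
    case True
    then show ?thesis using flows_agree_on_bridge[OF f f\<^sub>0(1) k bridge] f\<^sub>0(2)[OF k] by simp
  next
    case False
    then obtain i where i: "i \<in> {1..m}" "k \<in> arcs_within G (V i)"
      using k by (auto simp: contract_parts_def)
    have "finite (V i)" 
    proof (rule finite_subset)
      show "V i \<subseteq> verts G" using i(1) assms(5) by blast
    qed simp
    moreover have "bridge_in G (arcs G) j"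
      if "j \<in> arcs G" "(tail G j \<in> V i) \<noteq> (head G j \<in> V i)" for j
    proof (rule bridge)
      have "j \<notin> arcs_within G (V i')" if "i' \<in> {1..m}" for i'
        using assms(6)[OF i(1) that] \<open>(tail G j \<in> V i) \<noteq> (head G j \<in> V i)\<close>
        by (cases "i = i'") (auto simp: arcs_within_def)
      then show "j \<in> arcs (contract_parts G m V)" using that(1) by (simp add: contract_parts_def)
    qed
    ultimately have "\<bar>f k\<bar> \<le> sqrt (Max (B ` arcs G) / Min (B ` arcs G))
        * (sqrt (real (card (V i)) - 1) / 2) * norm1 G d"
      using i(2) by (intro potential_flow_within_part_le[OF f _ assms(3) inj, where \<theta> = \<theta>])
        (auto simp: f_def)
    also have "\<dots> \<le> sqrt (Max (B ` arcs G) / Min (B ` arcs G))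
        * (sqrt (real (Max ((\<lambda>i. card (V i)) ` {1..m})) - 1) / 2) * norm1 G d"
    proof -
      have "card (V i) \<le> Max ((\<lambda>i. card (V i)) ` {1..m})" using i(1) by (intro Max_ge) auto
      moreover have "0 \<le> Max (B ` arcs G) / Min (B ` arcs G)"
      proof -
        have "Max (B ` arcs G) \<in> B ` arcs G" "Min (B ` arcs G) \<in> B ` arcs G"
          using k by (auto intro!: Max_in Min_in)
        then show ?thesis using assms(3) by (auto intro!: divide_nonneg_nonneg less_imp_le)
      qed
      ultimately show ?thesis
        by (intro mult_right_mono mult_left_mono divide_right_mono) (auto simp: norm1_def sum_nonneg)
    qed
    also have "\<dots> \<le> F k" using i by (intro assms(9)) blast
    finally show ?thesis .
  qed
  with inj f show ?thesis unfolding dcopf_feasible_def f_def by blast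
qed

end
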